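(* Let $X$ and $Y$ be metric spaces such that the metric segment $[X,Y]$ in $\mathcal{GH}$ contains a metric space $Z$ with $d_{GH}(X,Z)>0$ and $d_{GH}(Y,Z)>0$. Then the metric segment $[X,Y]$ is a proper class.
   Context: All metric spaces are non-empty and have finite-valued metrics (they need be neither bounded nor compact). The Gromov--Hausdorff distance $d_{GH}(X,Y)\in[0,\infty]$ between metric spaces $X,Y$ is the infimum of those $r$ for which there exist a metric space $W$ and subsets $X',Y'\subset W$ isometric to $X$ and $Y$ respectively with Hausdorff distance $d_H(X',Y')\le r$, where $d_H(A,B)=\max\{\sup_{a\in A}\inf_{b\in B}|ab|,\ \sup_{b\in B}\inf_{a\in A}|ab|\}$. Note that $d_{GH}$ may be infinite, and may vanish on non-isometric spaces. $\mathcal{GH}$ denotes the proper class of all metric spaces considered up to isometry, endowed with $d_{GH}$. For $X,Y\in\mathcal{GH}$ the metric segment is $[X,Y]=\{Z\in\mathcal{GH}: d_{GH}(X,Z)+d_{GH}(Z,Y)=d_{GH}(X,Y)\}$ (an equality in $[0,\infty]$). Classes are understood in the sense of von Neumann--Bernays--Gödel set theory: a class is a set if it is an element of some class, and a proper class otherwise. Since the points of $\mathcal{GH}$ are metric spaces taken up to isometry, the assertion that $[X,Y]$ is a proper class (not a set) means that there is no set $S$ of metric spaces such that every metric space in $[X,Y]$ is isometric to some element of $S$. *)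

theory Defs
  imports "HOL-Analysis.Analysis"
begin

definition isometric :: "'a metric \<Rightarrow> 'b metric \<Rightarrow> bool" where
  "isometric X Y \<longleftrightarrow>
     (\<exists>f. bij_betw f (mspace X) (mspace Y) \<and>
          (\<forall>x\<in>mspace X. \<forall>y\<in>mspace X. mdist Y (f x) (f y) = mdist X x y))"

definition hausdorff_dist :: "'a metric \<Rightarrow> 'a set \<Rightarrow> 'a set \<Rightarrow> ennreal" where
  "hausdorff_dist W A B =
     max (SUP a\<in>A. INF b\<in>B. ennreal (mdist W a b))
         (SUP b\<in>B. INF a\<in>A. ennreal (mdist W a b))"

text \<open>
  A definition cannot quantify over types, so the ambient space \<open>W\<close> is taken in the type
  \<open>'a + 'b\<close>. This loses nothing: only the points of \<open>X' \<union> Y'\<close> matter, and these inject into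
  \<open>'a + 'b\<close>. Lemma \<open>gh_dist_le_ambient\<close> below shows that ambient spaces in other types
  do not lower the infimum.
\<close>

definition gh_dist :: "'a metric \<Rightarrow> 'b metric \<Rightarrow> ennreal" where
  "gh_dist X Y =
     Inf {r. \<exists>(W :: ('a + 'b) metric) X' Y'.
               X' \<subseteq> mspace W \<and> Y' \<subseteq> mspace W \<and>
               isometric (submetric W X') X \<and> isometric (submetric W Y') Y \<and>
               hausdorff_dist W X' Y' \<le> r}"

text \<open>
  The empty space is excluded explicitly, as \<^typ>\<open>'c metric\<close> contains it.
  The type \<open>'c\<close> is independent of \<open>'a\<close> and \<open>'b\<close>: the metric segment, a class, is represented
  by its parts in all types \<open>'c\<close>.

  A set of metric spaces is represented, up to isometry, by some \<open>S :: 's metric set\<close>, since the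
  disjoint union of the carriers of its members is a set and hence can serve as \<open>'s\<close>. Hence the segment
  is a proper class if for every type \<open>'s\<close> and every such \<open>S\<close> it has a member, in some type, that
  is isometric to no member of \<open>S\<close>. As types cannot be quantified existentially, the type of this
  member has to be named; it must have room for spaces with more points than \<open>'s\<close> has elements,
  hence a type built from \<open>'s set\<close>.
\<close>

definition metric_segment :: "'a metric \<Rightarrow> 'b metric \<Rightarrow> 'c metric set" where
  "metric_segment X Y =
     {Z. mspace Z \<noteq> {} \<and> gh_dist X Z + gh_dist Z Y = gh_dist X Y}"

lemma isometric_transport:
  assumes iso: "isometric (submetric W A) X" and A: "A \<subseteq> mspace W"
    and U: "A \<subseteq> U" and V: "mspace V = j ` U" and hj: "\<And>u. u \<in> U \<Longrightarrow> h (j u) = u"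
    and d: "mdist V = (\<lambda>p q. mdist W (h p) (h q))"
  shows "isometric (submetric V (j ` A)) X"
proof -
  from iso A obtain f where f: "bij_betw f A (mspace X)"
    and df: "\<And>x y. x \<in> A \<Longrightarrow> y \<in> A \<Longrightarrow> mdist X (f x) (f y) = mdist W x y"
    by (auto simp: isometric_def Int_absorb2)
  have sp: "mspace (submetric V (j ` A)) = j ` A"
    using V U by auto
  have "bij_betw h (j ` A) A"
    using hj U by (intro bij_betw_byWitness[where f' = j]) auto
  then have b: "bij_betw (f \<circ> h) (j ` A) (mspace X)"
    using f by (rule bij_betw_trans)
  have "\<forall>x\<in>j ` A. \<forall>y\<in>j ` A. mdist X ((f \<circ> h) x) ((f \<circ> h) y) = mdist V x y"
    using hj U df d by (auto simp: subset_iff)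
  with b show ?thesis
    unfolding isometric_def sp mdist_submetric by blast
qed

lemma gh_dist_le_ambient:
  fixes W :: "'w metric" and X :: "'a metric" and Y :: "'b metric"
  assumes A: "A \<subseteq> mspace W" and B: "B \<subseteq> mspace W"
    and X: "isometric (submetric W A) X" and Y: "isometric (submetric W B) Y"
  shows "gh_dist X Y \<le> hausdorff_dist W A B"
proof -
  from X A obtain f where f: "bij_betw f A (mspace X)"
    by (auto simp: isometric_def Int_absorb2)
  from Y B obtain g where g: "bij_betw g B (mspace Y)"
    by (auto simp: isometric_def Int_absorb2)
  define j :: "'w \<Rightarrow> 'a + 'b" where "j w = (if w \<in> A then Inl (f w) else Inr (g w))" for w
  define U where "U = A \<union> B"
  have inj: "inj_on j U"
    using f g by (auto simp: inj_on_def j_def U_def bij_betw_def)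
  define h where "h = inv_into U j"
  have hj: "h (j u) = u" if "u \<in> U" for u
    using inj that by (simp add: h_def)
  interpret W: Metric_space "mspace W" "mdist W"
    by (rule Metric_space_mspace_mdist)
  have UW: "U \<subseteq> mspace W" using A B by (simp add: U_def)
  have "Metric_space (j ` U) (\<lambda>p q. mdist W (h p) (h q))"
  proof
    fix x y assume "x \<in> j ` U" "y \<in> j ` U"
    then show "(mdist W (h x) (h y) = 0) = (x = y)"
      using hj UW by (auto simp: subset_iff)
  next
    fix x y z assume "x \<in> j ` U" "y \<in> j ` U" "z \<in> j ` U"
    then show "mdist W (h x) (h z) \<le> mdist W (h x) (h y) + mdist W (h y) (h z)"
      using hj UW W.triangle by (auto simp: subset_iff)
  qed (auto simp: W.commute)
  then have V: "mspace (metric (j ` U, \<lambda>p q. mdist W (h p) (h q))) = j ` U"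
    "mdist (metric (j ` U, \<lambda>p q. mdist W (h p) (h q))) = (\<lambda>p q. mdist W (h p) (h q))"
    by (simp_all add: Metric_space.mspace_metric Metric_space.mdist_metric)
  define V where "V = metric (j ` U, \<lambda>p q. mdist W (h p) (h q))"
  note V = V[folded V_def]
  have AU: "A \<subseteq> U" and BU: "B \<subseteq> U" by (auto simp: U_def)
  have "isometric (submetric V (j ` A)) X" "isometric (submetric V (j ` B)) Y"
    using isometric_transport[OF X A AU V(1) hj V(2)]
      isometric_transport[OF Y B BU V(1) hj V(2)] by auto
  moreover have "j ` A \<subseteq> mspace V" "j ` B \<subseteq> mspace V"
    using AU BU V by auto
  moreover have "hausdorff_dist V (j ` A) (j ` B) = hausdorff_dist W A B"
  proof -
    have "mdist V (j a) (j b) = mdist W a b" if "a \<in> A" "b \<in> B" for a b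
      using that hj AU BU V by (auto simp: subset_iff)
    then show ?thesis
      unfolding hausdorff_dist_def image_image
      by (intro arg_cong2[where f = max] SUP_cong INF_cong refl) auto
  qed
  ultimately show ?thesis
    unfolding gh_dist_def
    by (intro Inf_lower CollectI exI[of _ V] exI[of _ "j ` A"] exI[of _ "j ` B"]) simp
qed

end

theory Submission
  imports Defs
begin

text \<open>
  The space \<open>Z\<close> can be fattened without leaving the segment. Let \<open>Z'\<close> be the product of \<open>Z\<close> with a
  simplex, a set \<open>K\<close> of any cardinality whose points are at mutual distance \<open>e\<close>, under the maximum
  metric. A correspondence between \<open>X\<close> and \<open>Z\<close> pulls back along the projection \<open>Z' \<rightarrow> Z\<close> to one
  between \<open>X\<close> and \<open>Z'\<close>. The metrics of \<open>Z'\<close> and \<open>Z\<close> differ only where a distance in \<open>Z\<close> below \<open>e\<close>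
  is raised to \<open>e\<close>, so if the distortion was at least \<open>e\<close>, the pullback does not increase it.
  As no correspondence between \<open>X\<close> and \<open>Z\<close> has distortion below twice their distance,
  \<open>Z'\<close> is no farther from \<open>X\<close> than \<open>Z\<close> is, as soon as \<open>e\<close> is at most twice that distance
  (\<open>gh_dist_simplex_product_le\<close>). The same holds for \<open>Y\<close>. Since both distances are positive, one
  \<open>e > 0\<close> serves for both, and then \<open>d(X,Z') + d(Z',Y) \<le> d(X,Z) + d(Z,Y) = d(X,Y)\<close>.
  By the triangle inequality (\<open>gh_dist_triangle\<close>), \<open>Z'\<close> lies in the segment. This covers infinite
  distances as well.

  The cardinality of \<open>K\<close> was arbitrary: with \<open>K\<close> the power set of \<open>'s\<close>, Cantor's theorem prevents
  \<open>Z'\<close> from being isometric to a space whose points lie in \<open>'s\<close>.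

  Both estimates compare distortions, so they rest on the description of the Gromov-Hausdorff distance
  as half the infimum of the distortions of correspondences (\<open>gh_dist_eq_INF_correspondence\<close>).
\<close>

section \<open>Gromov-Hausdorff distance and correspondences\<close>

text \<open>
  The bound on the distortion is \<open>2 * r\<close>, so that \<open>r\<close> is comparable to a Gromov-Hausdorff distance.
\<close>

definition correspondence :: "'a metric \<Rightarrow> 'b metric \<Rightarrow> real \<Rightarrow> ('a \<times> 'b) set \<Rightarrow> bool" where
  "correspondence X Y r R \<longleftrightarrow>
     Domain R = mspace X \<and> Range R = mspace Y \<and>
     (\<forall>(x, y)\<in>R. \<forall>(x', y')\<in>R. \<bar>mdist X x x' - mdist Y y y'\<bar> \<le> 2 * r)"

lemma correspondenceI:
  assumes "Domain R = mspace X" "Range R = mspace Y"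
    and "\<And>x y x' y'. (x, y) \<in> R \<Longrightarrow> (x', y') \<in> R \<Longrightarrow> \<bar>mdist X x x' - mdist Y y y'\<bar> \<le> 2 * r"
  shows "correspondence X Y r R"
  using assms unfolding correspondence_def by auto

lemma correspondence_distortion:
  assumes "correspondence X Y r R" "(x, y) \<in> R" "(x', y') \<in> R"
  shows "mdist X x x' \<le> mdist Y y y' + 2 * r" "mdist Y y y' \<le> mdist X x x' + 2 * r"
  using assms unfolding correspondence_def by fastforce+

lemma correspondence_in_mspace:
  assumes "correspondence X Y r R" "(x, y) \<in> R"
  shows "x \<in> mspace X" "y \<in> mspace Y"
  using assms unfolding correspondence_def by blast+

lemma correspondence_converse:
  "correspondence X Y r R \<Longrightarrow> correspondence Y X r (R\<inverse>)"
  unfolding correspondence_def by (fastforce simp: abs_minus_commute)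

lemma correspondence_relcomp:
  assumes R: "correspondence X Y r R" and S: "correspondence Y Z s S"
  shows "correspondence X Z (r + s) (R O S)"
proof -
  have "Range R = Domain S"
    using R S by (simp add: correspondence_def)
  then have "Domain (R O S) = Domain R" "Range (R O S) = Range S"
    by blast+
  then have "Domain (R O S) = mspace X" "Range (R O S) = mspace Z"
    using R S by (simp_all add: correspondence_def)
  moreover have "\<bar>mdist X x x' - mdist Z z z'\<bar> \<le> 2 * (r + s)"
    if "(x, z) \<in> R O S" "(x', z') \<in> R O S" for x z x' z'
  proof -
    from that obtain y y' where "(x, y) \<in> R" "(y, z) \<in> S" "(x', y') \<in> R" "(y', z') \<in> S"
      by blast
    then show ?thesis
      using correspondence_distortion[OF R, of x y x' y'] correspondence_distortion[OF S, of y z y' z']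
      by (auto simp: abs_le_iff)
  qed
  ultimately show ?thesis
    by (rule correspondenceI)
qed

text \<open>
  Passing from \<open>x\<close> to \<open>y\<close> means walking inside \<open>X\<close>, jumping across a corresponding pair at cost \<open>r\<close>,
  and walking inside \<open>Y\<close>. Two jumps cost \<open>2 * r\<close>, which pays for the distortion, so detours through the
  other space are never shortcuts; and \<open>r > 0\<close> keeps the two spaces disjoint.
\<close>

definition jump_dist :: "'a metric \<Rightarrow> 'b metric \<Rightarrow> real \<Rightarrow> ('a \<times> 'b) set \<Rightarrow> 'a \<Rightarrow> 'b \<Rightarrow> real" where
  "jump_dist X Y r R x y = (INF (x', y')\<in>R. mdist X x x' + r + mdist Y y y')"

fun glued_dist :: "'a metric \<Rightarrow> 'b metric \<Rightarrow> real \<Rightarrow> ('a \<times> 'b) set \<Rightarrow> 'a + 'b \<Rightarrow> 'a + 'b \<Rightarrow> real" where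
  "glued_dist X Y r R (Inl x) (Inl x') = mdist X x x'"
| "glued_dist X Y r R (Inr y) (Inr y') = mdist Y y y'"
| "glued_dist X Y r R (Inl x) (Inr y) = jump_dist X Y r R x y"
| "glued_dist X Y r R (Inr y) (Inl x) = jump_dist X Y r R x y"

lemma jump_dist_le:
  assumes "0 < r" "(x', y') \<in> R"
  shows "jump_dist X Y r R x y \<le> mdist X x x' + r + mdist Y y y'"
proof -
  have "bdd_below ((\<lambda>(x', y'). mdist X x x' + r + mdist Y y y') ` R)"
    using assms(1) by (intro bdd_belowI[of _ 0]) auto
  from cINF_lower[OF this assms(2)] show ?thesis
    by (simp add: jump_dist_def)
qed

lemma jump_dist_greatest:
  assumes "R \<noteq> {}" and "\<And>x' y'. (x', y') \<in> R \<Longrightarrow> c \<le> mdist X x x' + r + mdist Y y y'"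
  shows "c \<le> jump_dist X Y r R x y"
  unfolding jump_dist_def using assms by (intro cINF_greatest) auto

text \<open>
  The map \<open>R \<mapsto> R\<inverse>\<close> exchanges the roles of the two spaces, so that each triangle inequality
  need only be checked for one of them.
\<close>

lemma jump_dist_converse: "jump_dist Y X r (R\<inverse>) y x = jump_dist X Y r R x y"
proof -
  have "(\<lambda>(y', x'). mdist Y y y' + r + mdist X x x') ` (R\<inverse>)
      = (\<lambda>(x', y'). mdist X x x' + r + mdist Y y y') ` R"
    by (force simp: image_iff algebra_simps)
  then show ?thesis
    by (simp add: jump_dist_def)
qed

lemma jump_dist_ge:
  assumes R: "correspondence X Y r R" and x: "x \<in> mspace X"
  shows "r \<le> jump_dist X Y r R x y"
proof (rule jump_dist_greatest)
  show "R \<noteq> {}" using R x by (auto simp: correspondence_def)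
qed simp

lemma jump_dist_triangle_left:
  assumes R: "correspondence X Y r R" and r: "0 < r"
    and x: "x1 \<in> mspace X" "x2 \<in> mspace X"
  shows "jump_dist X Y r R x1 y \<le> mdist X x1 x2 + jump_dist X Y r R x2 y"
proof -
  have "jump_dist X Y r R x1 y - mdist X x1 x2 \<le> jump_dist X Y r R x2 y"
  proof (rule jump_dist_greatest)
    show "R \<noteq> {}" using R x by (auto simp: correspondence_def)
    fix x' y' assume *: "(x', y') \<in> R"
    show "jump_dist X Y r R x1 y - mdist X x1 x2 \<le> mdist X x2 x' + r + mdist Y y y'"
      using jump_dist_le[OF r *, of X Y x1 y] mdist_triangle[OF x, of x']
        correspondence_in_mspace[OF R *]
      by linarith
  qed
  then show ?thesis by simp
qed

lemma jump_dist_triangle_across: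
  assumes R: "correspondence X Y r R"
    and x: "x1 \<in> mspace X" "x2 \<in> mspace X" and y: "y \<in> mspace Y"
  shows "mdist X x1 x2 \<le> jump_dist X Y r R x1 y + jump_dist X Y r R x2 y"
proof -
  have ne: "R \<noteq> {}" using R x by (auto simp: correspondence_def)
  have "mdist X x1 x2 - jump_dist X Y r R x2 y \<le> jump_dist X Y r R x1 y"
  proof (rule jump_dist_greatest[OF ne])
    fix u v assume uv: "(u, v) \<in> R"
    have "mdist X x1 x2 - (mdist X x1 u + r + mdist Y y v) \<le> jump_dist X Y r R x2 y"
    proof (rule jump_dist_greatest[OF ne])
      fix u' v' assume uv': "(u', v') \<in> R"
      note in_spaces = correspondence_in_mspace[OF R uv] correspondence_in_mspace[OF R uv']
      have "mdist X x1 x2 \<le> mdist X x1 u + mdist X u u' + mdist X x2 u'"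
        using mdist_triangle[of x1 X u x2] mdist_triangle[of u X u' x2] x in_spaces
        by (simp add: mdist_commute)
      moreover have "mdist Y v v' \<le> mdist Y y v + mdist Y y v'"
        using mdist_triangle[of v Y y v'] y in_spaces by (simp add: mdist_commute)
      ultimately show "mdist X x1 x2 - (mdist X x1 u + r + mdist Y y v) \<le> mdist X x2 u' + r + mdist Y y v'"
        using correspondence_distortion(1)[OF R uv uv'] by linarith
    qed
    then show "mdist X x1 x2 - jump_dist X Y r R x2 y \<le> mdist X x1 u + r + mdist Y y v"
      by linarith
  qed
  then show ?thesis by linarith
qed

text \<open>
  Over an empty \<open>R\<close>, \<open>jump_dist\<close> would be the infimum of the empty set, an unspecified real number
  that might be negative, whereas a metric is non-negative even off its carrier.
\<close>

lemma Metric_space_glued_dist: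
  assumes R: "correspondence X Y r R" and ne: "R \<noteq> {}" and r: "0 < r"
  shows "Metric_space (Inl ` mspace X \<union> Inr ` mspace Y) (glued_dist X Y r R)"
proof
  note R' = correspondence_converse[OF R]
  have pos: "0 < jump_dist X Y r R x y" if "x \<in> mspace X" for x y
    using jump_dist_ge[OF R that] r by (rule order_less_le_trans[rotated])
  show "0 \<le> glued_dist X Y r R p q" for p q
  proof -
    have "0 \<le> jump_dist X Y r R x y" for x y
      using ne r by (intro jump_dist_greatest) auto
    then show ?thesis by (cases p; cases q) auto
  qed
  show "glued_dist X Y r R p q = glued_dist X Y r R q p" for p q
    by (cases p; cases q) (auto simp: mdist_commute)
  show "(glued_dist X Y r R p q = 0) = (p = q)"
    if "p \<in> Inl ` mspace X \<union> Inr ` mspace Y" "q \<in> Inl ` mspace X \<union> Inr ` mspace Y" for p q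
    using that pos by (auto simp: less_imp_neq[symmetric])
  show "glued_dist X Y r R p s \<le> glued_dist X Y r R p q + glued_dist X Y r R q s"
    if "p \<in> Inl ` mspace X \<union> Inr ` mspace Y" "q \<in> Inl ` mspace X \<union> Inr ` mspace Y"
      "s \<in> Inl ` mspace X \<union> Inr ` mspace Y" for p q s
  proof -
    note across = jump_dist_triangle_across[OF R]
      jump_dist_triangle_across[OF R', unfolded jump_dist_converse]
    note left = jump_dist_triangle_left[OF R r]
      jump_dist_triangle_left[OF R' r, unfolded jump_dist_converse]
    show ?thesis
    proof (cases p; cases q; cases s)
      fix x y x' assume "p = Inl x" "q = Inl y" "s = Inl x'"
      then show ?thesis using that mdist_triangle[of x X y x'] by auto
    next
      fix x y x' assume "p = Inr x" "q = Inr y" "s = Inr x'"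
      then show ?thesis using that mdist_triangle[of x Y y x'] by auto
    next
      fix x y x' assume "p = Inl x" "q = Inl y" "s = Inr x'"
      then show ?thesis using that left(1)[of x y x'] by auto
    next
      fix x y x' assume "p = Inr x" "q = Inl y" "s = Inl x'"
      then show ?thesis using that left(1)[of x' y x] by (auto simp: mdist_commute)
    next
      fix x y x' assume "p = Inr x" "q = Inr y" "s = Inl x'"
      then show ?thesis using that left(2)[of x y x'] by auto
    next
      fix x y x' assume "p = Inl x" "q = Inr y" "s = Inr x'"
      then show ?thesis using that left(2)[of x' y x] by (auto simp: mdist_commute)
    next
      fix x y x' assume "p = Inl x" "q = Inr y" "s = Inl x'"
      then show ?thesis using that across(1)[of x x' y] by auto
    next
      fix x y x' assume "p = Inr x" "q = Inl y" "s = Inr x'"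
      then show ?thesis using that across(2)[of x x' y] by auto
    qed
  qed
qed

lemma gh_dist_le_correspondence:
  assumes R: "correspondence X Y r R" and r: "0 < r"
  shows "gh_dist X Y \<le> ennreal r"
proof (cases "R = {}")
  case True
  then have "mspace X = {}" "mspace Y = {}"
    using R by (auto simp: correspondence_def)
  then have "gh_dist X Y \<le> hausdorff_dist X {} {}"
    by (intro gh_dist_le_ambient) (auto simp: isometric_def bij_betw_def)
  then show ?thesis
    by (simp add: hausdorff_dist_def bot_ennreal)
next
  case False
  define V where "V = metric (Inl ` mspace X \<union> Inr ` mspace Y, glued_dist X Y r R)"
  have V: "mspace V = Inl ` mspace X \<union> Inr ` mspace Y" "mdist V = glued_dist X Y r R"
    unfolding V_def using Metric_space_glued_dist[OF R False r]
    by (simp_all add: Metric_space.mspace_metric Metric_space.mdist_metric)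
  have X: "isometric (submetric V (Inl ` mspace X)) X"
    unfolding isometric_def
    by (rule exI[of _ projl])
      (auto simp: V bij_betw_def inj_on_def image_image Int_absorb2 simp flip: image_Un)
  have Y: "isometric (submetric V (Inr ` mspace Y)) Y"
    unfolding isometric_def
    by (rule exI[of _ projr])
      (auto simp: V bij_betw_def inj_on_def image_image Int_absorb2 simp flip: image_Un)
  have jump: "ennreal (jump_dist X Y r R x y) \<le> ennreal r" if "(x, y) \<in> R" for x y
  proof (rule ennreal_leI)
    have "mdist X x x = 0" "mdist Y y y = 0"
      using correspondence_in_mspace[OF R that] by simp_all
    then show "jump_dist X Y r R x y \<le> r"
      using jump_dist_le[OF r that, of X Y x y] by simp
  qed
  have "hausdorff_dist V (Inl ` mspace X) (Inr ` mspace Y) \<le> ennreal r"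
    unfolding hausdorff_dist_def
  proof (intro max.boundedI SUP_least)
    fix a :: "'a + 'b" assume "a \<in> Inl ` mspace X"
    then obtain x where "a = Inl x" "x \<in> Domain R" using R unfolding correspondence_def by blast
    then obtain y where "a = Inl x" "(x, y) \<in> R" by blast
    then show "(INF b\<in>Inr ` mspace Y. ennreal (mdist V a b)) \<le> ennreal r"
      using jump correspondence_in_mspace[OF R] by (intro INF_lower2[of "Inr y"]) (auto simp: V)
  next
    fix b :: "'a + 'b" assume "b \<in> Inr ` mspace Y"
    then obtain y where "b = Inr y" "y \<in> Range R" using R unfolding correspondence_def by blast
    then obtain x where "b = Inr y" "(x, y) \<in> R" by blast
    then show "(INF a\<in>Inl ` mspace X. ennreal (mdist V a b)) \<le> ennreal r"
      using jump correspondence_in_mspace[OF R] by (intro INF_lower2[of "Inl x"]) (auto simp: V)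
  qed
  moreover have "gh_dist X Y \<le> hausdorff_dist V (Inl ` mspace X) (Inr ` mspace Y)"
    using X Y by (intro gh_dist_le_ambient) (auto simp: V)
  ultimately show ?thesis by (rule order_trans[rotated])
qed

text \<open>
  Inside a common space, points at distance less than \<open>r\<close> correspond; distances between points then
  change by at most \<open>2 * r\<close>.
\<close>

lemma gh_dist_less_correspondence:
  fixes X :: "'a metric" and Y :: "'b metric"
  assumes "gh_dist X Y < c"
  obtains r R where "0 < r" "ennreal r < c" "correspondence X Y r R"
proof -
  from assms obtain W :: "('a + 'b) metric" and A B where
    A: "A \<subseteq> mspace W" and B: "B \<subseteq> mspace W"
    and X: "isometric (submetric W A) X" and Y: "isometric (submetric W B) Y"
    and W: "hausdorff_dist W A B < c"
    unfolding gh_dist_def Inf_less_iff by (auto intro: order_le_less_trans)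
  from X A obtain f where f: "bij_betw f A (mspace X)"
    and df: "\<And>x y. x \<in> A \<Longrightarrow> y \<in> A \<Longrightarrow> mdist X (f x) (f y) = mdist W x y"
    by (auto simp: isometric_def Int_absorb2)
  from Y B obtain g where g: "bij_betw g B (mspace Y)"
    and dg: "\<And>x y. x \<in> B \<Longrightarrow> y \<in> B \<Longrightarrow> mdist Y (g x) (g y) = mdist W x y"
    by (auto simp: isometric_def Int_absorb2)
  from dense[OF W] obtain t where t: "hausdorff_dist W A B < t" "t < c" by blast
  define r where "r = enn2real t"
  have tr: "t = ennreal r"
    using t by (cases t) (auto simp: r_def)
  have "0 < ennreal r" unfolding tr[symmetric] using zero_le t(1) by (rule order_le_less_trans)
  then have r: "0 < r" by simp
  define R where "R = {(f a, g b) |a b. a \<in> A \<and> b \<in> B \<and> mdist W a b < r}"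
  have near: "\<exists>b\<in>B. mdist W a b < r" if "a \<in> A" for a
  proof -
    have "(INF b\<in>B. ennreal (mdist W a b)) \<le> hausdorff_dist W A B"
      unfolding hausdorff_dist_def using that by (intro max.coboundedI1 SUP_upper)
    with t(1) have "(INF b\<in>B. ennreal (mdist W a b)) < ennreal r" by (simp add: tr)
    then show ?thesis by (auto simp: INF_less_iff ennreal_less_iff)
  qed
  have near': "\<exists>a\<in>A. mdist W a b < r" if "b \<in> B" for b
  proof -
    have "(INF a\<in>A. ennreal (mdist W a b)) \<le> hausdorff_dist W A B"
      unfolding hausdorff_dist_def using that by (intro max.coboundedI2 SUP_upper)
    with t(1) have "(INF a\<in>A. ennreal (mdist W a b)) < ennreal r" by (simp add: tr)
    then show ?thesis by (auto simp: INF_less_iff ennreal_less_iff)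
  qed
  have "Domain R = f ` A" "Range R = g ` B"
    using near near' unfolding R_def by blast+
  then have "Domain R = mspace X" "Range R = mspace Y"
    using f g by (auto simp: bij_betw_def)
  moreover have "\<bar>mdist X x x' - mdist Y y y'\<bar> \<le> 2 * r"
    if xy: "(x, y) \<in> R" and xy': "(x', y') \<in> R" for x y x' y'
  proof -
    from xy obtain a b where ab: "x = f a" "y = g b" "a \<in> A" "b \<in> B" "mdist W a b < r"
      by (auto simp: R_def)
    from xy' obtain a' b' where ab': "x' = f a'" "y' = g b'" "a' \<in> A" "b' \<in> B" "mdist W a' b' < r"
      by (auto simp: R_def)
    have W4: "a \<in> mspace W" "b \<in> mspace W" "a' \<in> mspace W" "b' \<in> mspace W"
      using ab ab' A B by auto
    have "mdist W a a' \<le> mdist W a b + mdist W b b' + mdist W a' b'"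
      using mdist_triangle[of a W b a'] mdist_triangle[of b W b' a'] W4 by (simp add: mdist_commute)
    moreover have "mdist W b b' \<le> mdist W a b + mdist W a a' + mdist W a' b'"
      using mdist_triangle[of b W a b'] mdist_triangle[of a W a' b'] W4 by (simp add: mdist_commute)
    ultimately show ?thesis
      using ab ab' by (simp add: df dg abs_le_iff)
  qed
  ultimately have "correspondence X Y r R"
    by (rule correspondenceI)
  with r t(2) show thesis by (intro that) (auto simp: tr)
qed

theorem gh_dist_eq_INF_correspondence:
  "gh_dist X Y = (INF r\<in>{r. 0 < r \<and> (\<exists>R. correspondence X Y r R)}. ennreal r)"
proof (rule antisym)
  show "gh_dist X Y \<le> (INF r\<in>{r. 0 < r \<and> (\<exists>R. correspondence X Y r R)}. ennreal r)"
    by (rule INF_greatest) (auto intro: gh_dist_le_correspondence)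
  show "(INF r\<in>{r. 0 < r \<and> (\<exists>R. correspondence X Y r R)}. ennreal r) \<le> gh_dist X Y"
  proof (rule ccontr)
    assume "\<not> ?thesis"
    then have "gh_dist X Y < (INF r\<in>{r. 0 < r \<and> (\<exists>R. correspondence X Y r R)}. ennreal r)"
      by simp
    then obtain r R where r: "0 < r" "correspondence X Y r R"
      and less: "ennreal r < (INF r\<in>{r. 0 < r \<and> (\<exists>R. correspondence X Y r R)}. ennreal r)"
      by (rule gh_dist_less_correspondence)
    from r have "(INF r\<in>{r. 0 < r \<and> (\<exists>R. correspondence X Y r R)}. ennreal r) \<le> ennreal r"
      by (intro INF_lower) auto
    with less show False by simp
  qed
qed

lemma gh_dist_commute: "gh_dist X Y = gh_dist Y X"
proof -
  have "(\<exists>R. correspondence X Y r R) \<longleftrightarrow> (\<exists>R. correspondence Y X r R)" for r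
    by (blast intro: correspondence_converse)
  then show ?thesis
    by (simp add: gh_dist_eq_INF_correspondence)
qed

text \<open>Correspondences compose, and their distortions add up.\<close>

lemma gh_dist_triangle: "gh_dist X Z \<le> gh_dist X Y + gh_dist Y Z"
proof (rule ennreal_le_epsilon)
  fix e :: real assume fin: "gh_dist X Y + gh_dist Y Z < top" and e: "0 < e"
  have "gh_dist X Y < gh_dist X Y + ennreal (e / 2)" "gh_dist Y Z < gh_dist Y Z + ennreal (e / 2)"
    using fin e
    by (auto simp: less_top[symmetric]
        intro!: ennreal_add_left_cancel_less[THEN iffD2, of _ 0, simplified])
  then obtain r R s S where r: "0 < r" "ennreal r < gh_dist X Y + ennreal (e / 2)" "correspondence X Y r R"
    and s: "0 < s" "ennreal s < gh_dist Y Z + ennreal (e / 2)" "correspondence Y Z s S"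
    by (meson gh_dist_less_correspondence)
  have "gh_dist X Z \<le> ennreal (r + s)"
    using r s by (intro gh_dist_le_correspondence[OF correspondence_relcomp]) auto
  also have "\<dots> = ennreal r + ennreal s"
    using r s by simp
  also have "\<dots> \<le> (gh_dist X Y + ennreal (e / 2)) + (gh_dist Y Z + ennreal (e / 2))"
    using r s by (intro add_mono) auto
  also have "\<dots> = gh_dist X Y + gh_dist Y Z + (ennreal (e / 2) + ennreal (e / 2))"
    by (simp add: ac_simps)
  also have "ennreal (e / 2) + ennreal (e / 2) = ennreal e"
    using e by (simp flip: ennreal_plus)
  finally show "gh_dist X Z \<le> gh_dist X Y + gh_dist Y Z + ennreal e" .
qed

section \<open>Products with a simplex\<close>

text \<open>
  Every point of the whole space is multiplied, and the maximum is taken, because multiplying a single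
  point would break the triangle inequality if other points of \<open>Z\<close> come closer to it than \<open>e / 2\<close>.
\<close>

definition simplex_product :: "real \<Rightarrow> 'c metric \<Rightarrow> ('c \<times> 'k) metric" where
  "simplex_product e Z =
     metric (mspace Z \<times> UNIV, \<lambda>(z, k) (w, l). max (mdist Z z w) (if k = l then 0 else e))"

lemma
  fixes Z :: "'c metric" and k l :: 'k
  assumes "0 < e"
  shows mspace_simplex_product:
      "mspace (simplex_product e Z :: ('c \<times> 'k) metric) = mspace Z \<times> UNIV"
    and mdist_simplex_product:
      "mdist (simplex_product e Z) (z, k) (w, l) = max (mdist Z z w) (if k = l then 0 else e)"
proof -
  have "Metric_space (mspace Z \<times> UNIV)
          (\<lambda>(z, k :: 'k) (w, l). max (mdist Z z w) (if k = l then 0 else e))"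
  proof
    show "(case p of (z, k) \<Rightarrow> \<lambda>(w, l). max (mdist Z z w) (if k = l then 0 else e)) s
        \<le> (case p of (z, k) \<Rightarrow> \<lambda>(w, l). max (mdist Z z w) (if k = l then 0 else e)) q
          + (case q of (z, k) \<Rightarrow> \<lambda>(w, l). max (mdist Z z w) (if k = l then 0 else e)) s"
      if "p \<in> mspace Z \<times> UNIV" "q \<in> mspace Z \<times> UNIV" "s \<in> mspace Z \<times> UNIV" for p q s :: "'c \<times> 'k"
    proof -
      obtain z k w l v m where pqs: "p = (z, k)" "q = (w, l)" "s = (v, m)"
        by (metis surj_pair)
      then have "mdist Z z v \<le> mdist Z z w + mdist Z w v"
        using that by (intro mdist_triangle) auto
      then show ?thesis
        using assms mdist_nonneg[of Z z w] mdist_nonneg[of Z w v]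
        unfolding pqs prod.case max_def by (smt (verit))
    qed
  next
    show "((case p of (z, k) \<Rightarrow> \<lambda>(w, l). max (mdist Z z w) (if k = l then 0 else e)) q = 0) = (p = q)"
      if "p \<in> mspace Z \<times> UNIV" "q \<in> mspace Z \<times> UNIV" for p q :: "'c \<times> 'k"
    proof -
      obtain z k w l where pq: "p = (z, k)" "q = (w, l)"
        by (metis surj_pair)
      then have "mdist Z z w = 0 \<longleftrightarrow> z = w"
        using that by (intro mdist_zero) auto
      then show ?thesis
        using assms mdist_nonneg[of Z z w] unfolding pq prod.case max_def prod.inject
        by (smt (verit))
    qed
  qed (auto simp: mdist_commute le_max_iff_disj)
  then show "mspace (simplex_product e Z :: ('c \<times> 'k) metric) = mspace Z \<times> UNIV"
    and "mdist (simplex_product e Z) (z, k) (w, l) = max (mdist Z z w) (if k = l then 0 else e)"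
    by (simp_all add: simplex_product_def Metric_space.mspace_metric Metric_space.mdist_metric)
qed

text \<open>
  The pulled-back correspondence exceeds the old distortion only where a distance in \<open>Z\<close> below \<open>e\<close>
  was raised to \<open>e\<close> above the distance in \<open>X\<close>, and then the new defect is at most \<open>e \<le> 2 * r\<close>.
\<close>

lemma correspondence_simplex_product:
  assumes R: "correspondence X Z r R" and e: "0 < e" "e \<le> 2 * r"
  shows "correspondence X (simplex_product e Z) r {(x, (z, k)) |x z k. (x, z) \<in> R}"
    (is "correspondence _ _ _ ?R'")
proof -
  have "Domain ?R' = Domain R" "Range ?R' = Range R \<times> UNIV"
    by blast+
  then have "Domain ?R' = mspace X" "Range ?R' = mspace (simplex_product e Z)"
    using R by (auto simp: correspondence_def mspace_simplex_product[OF e(1)])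
  moreover have "\<bar>mdist X x x' - mdist (simplex_product e Z) (z, k) (z', k')\<bar> \<le> 2 * r"
    if "(x, z) \<in> R" "(x', z') \<in> R" for x z x' z' and k k' :: 'c
    using correspondence_distortion[OF R that] mdist_nonneg[of X x x'] mdist_nonneg[of Z z z'] e
    unfolding mdist_simplex_product[OF e(1)] max_def by (smt (verit))
  ultimately show ?thesis
    by (intro correspondenceI) auto
qed

lemma gh_dist_simplex_product_le:
  assumes e: "0 < e" "ennreal (e / 2) \<le> gh_dist X Z"
  shows "gh_dist X (simplex_product e Z) \<le> gh_dist X Z"
  unfolding gh_dist_eq_INF_correspondence[of X Z]
proof (rule INF_greatest)
  fix r assume "r \<in> {r. 0 < r \<and> (\<exists>R. correspondence X Z r R)}"
  then obtain R where r: "0 < r" and R: "correspondence X Z r R" by blast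
  have "ennreal (e / 2) \<le> ennreal r"
    using e(2) gh_dist_le_correspondence[OF R r] by (rule order_trans)
  then have "e \<le> 2 * r" using r by (simp add: ennreal_le_iff)
  then show "gh_dist X (simplex_product e Z) \<le> ennreal r"
    by (rule gh_dist_le_correspondence[OF correspondence_simplex_product[OF R e(1)] r])
qed

lemma simplex_product_in_metric_segment:
  fixes Z :: "'c metric"
  assumes Z: "Z \<in> metric_segment X Y"
    and e: "0 < e" "ennreal (e / 2) \<le> gh_dist X Z" "ennreal (e / 2) \<le> gh_dist Y Z"
  shows "(simplex_product e Z :: ('c \<times> 'k) metric) \<in> metric_segment X Y"
proof -
  let ?Z' = "simplex_product e Z :: ('c \<times> 'k) metric"
  have "gh_dist X ?Z' + gh_dist ?Z' Y
      \<le> gh_dist X Z + gh_dist Z Y"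
    using gh_dist_simplex_product_le[OF e(1,2)] gh_dist_simplex_product_le[OF e(1,3)]
    unfolding gh_dist_commute[of _ Y] by (rule add_mono)
  also have "\<dots> = gh_dist X Y"
    using Z by (simp add: metric_segment_def)
  finally have "gh_dist X ?Z' + gh_dist ?Z' Y = gh_dist X Y"
    using gh_dist_triangle[of X Y ?Z'] by (rule antisym)
  then show ?thesis
    using Z by (simp add: metric_segment_def mspace_simplex_product[OF e(1)])
qed

lemma simplex_product_not_isometric:
  fixes Z :: "'c metric" and M :: "'s metric"
  assumes "mspace Z \<noteq> {}" "0 < e"
  shows "\<not> isometric (simplex_product e Z :: ('c \<times> 's set) metric) M"
proof
  assume "isometric (simplex_product e Z :: ('c \<times> 's set) metric) M"
  then obtain f :: "'c \<times> 's set \<Rightarrow> 's" where f: "inj_on f (mspace Z \<times> UNIV)"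
    using assms(2) by (auto simp: isometric_def bij_betw_def mspace_simplex_product)
  from assms(1) obtain z where "z \<in> mspace Z" by blast
  with f have "inj (\<lambda>A. f (z, A))" by (auto simp: inj_on_def)
  then have "surj (inv (\<lambda>A. f (z, A)))" by (rule inj_imp_surj_inv)
  then show False
    using Cantors_theorem[of "UNIV :: 's set"] by auto
qed

section \<open>Metric segments with an interior point\<close>

theorem corollary1:
  fixes X :: "'a metric" and Y :: "'b metric" and Z :: "'c metric"
  assumes "mspace X \<noteq> {}" and "mspace Y \<noteq> {}"
    and "Z \<in> metric_segment X Y"
    and "gh_dist X Z > 0" and "gh_dist Y Z > 0"
  shows "\<not> (\<exists>S :: 's metric set.
              \<forall>W \<in> (metric_segment X Y :: ('c \<times> 's set) metric set).
                \<exists>M\<in>S. isometric W M)"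
proof -
  from assms(4,5) have "0 < min (gh_dist X Z) (gh_dist Y Z)" by simp
  from dense[OF this] obtain t where t: "0 < t" "t < min (gh_dist X Z) (gh_dist Y Z)" by blast
  define e where "e = 2 * enn2real t"
  have fin: "t < top" using t(2) by (rule order_less_le_trans) simp
  have e: "0 < e" using t(1) fin by (simp add: e_def enn2real_positive_iff)
  have half: "ennreal (e / 2) = t" using fin by (simp add: e_def)
  have "ennreal (e / 2) \<le> gh_dist X Z" "ennreal (e / 2) \<le> gh_dist Y Z"
    using t(2) unfolding half by (simp_all add: less_imp_le)
  then have "(simplex_product e Z :: ('c \<times> 's set) metric) \<in> metric_segment X Y"
    by (rule simplex_product_in_metric_segment[OF assms(3) e])
  moreover have "mspace Z \<noteq> {}"
    using assms(3) by (simp add: metric_segment_def)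
  then have "\<not> isometric (simplex_product e Z :: ('c \<times> 's set) metric) M" for M :: "'s metric"
    using e by (rule simplex_product_not_isometric)
  ultimately show ?thesis
    by blast
qed

end
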